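(* Let $n\ge 2$ and let $a_1,a_2,\dotsc,a_n$ be non-negative real numbers. Let $2\le k\le n$ and set \[ \bar{a}=\frac{1}{k-1}(a_1+a_2+\dotsb+a_n). \] Let $a\ge 0$. Then the following are equivalent: (i) there exist Lebesgue measurable subsets $A_1,A_2,\dotsc,A_n$ of a Euclidean space, with Lebesgue measure $\mu$, such that $\mu(A_i)=a_i$ for all $i$, $\mu(A_1\cup\dotsb\cup A_n)=a$, and the intersection of any $k$ of the sets $A_1,\dotsc,A_n$ (with distinct indices) is empty; (ii) $\max\{a_1,a_2,\dotsc,a_n,\bar{a}\}\le a\le a_1+a_2+\dotsb+a_n$. Moreover, if $a_1,\dotsc,a_n$ and $a$ are non-negative integers, then the same equivalence holds with (i) replaced by: there exist finite sets $A_1,\dotsc,A_n$ such that $|A_i|=a_i$ for all $i$, $|A_1\cup\dotsb\cup A_n|=a$, and the intersection of any $k$ of the sets $A_1,\dotsc,A_n$ (with distinct indices) is empty.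
   Context: $\mu$ denotes Lebesgue measure in the measure case and cardinality in the finite-set case. *)

theory Defs
  imports "HOL-Analysis.Analysis" "HOL-Library.Infinite_Typeclass"
begin

definition k_intersections_empty :: "nat \<Rightarrow> nat \<Rightarrow> (nat \<Rightarrow> 'a set) \<Rightarrow> bool" where
  "k_intersections_empty n k A \<longleftrightarrow>
     (\<forall>I. I \<subseteq> {1..n} \<and> card I = k \<longrightarrow> (\<Inter>i\<in>I. A i) = {})"

definition a_bar :: "nat \<Rightarrow> nat \<Rightarrow> (nat \<Rightarrow> real) \<Rightarrow> real" where
  "a_bar n k a = 1 / (real k - 1) * (\<Sum>i=1..n. a i)"

text \<open>Measures are compared in the extended non-negative reals, so that a set of infinite
  measure is not mistaken for a null set.\<close>

definition lebesgue_realizes ::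
  "nat \<Rightarrow> nat \<Rightarrow> (nat \<Rightarrow> real) \<Rightarrow> real \<Rightarrow> (nat \<Rightarrow> 'e::euclidean_space set) \<Rightarrow> bool" where
  "lebesgue_realizes n k a s A \<longleftrightarrow>
     (\<forall>i\<in>{1..n}. A i \<in> sets lebesgue \<and> emeasure lebesgue (A i) = ennreal (a i)) \<and>
     emeasure lebesgue (\<Union>i\<in>{1..n}. A i) = ennreal s \<and>
     k_intersections_empty n k A"

definition finite_realizes ::
  "nat \<Rightarrow> nat \<Rightarrow> (nat \<Rightarrow> real) \<Rightarrow> real \<Rightarrow> (nat \<Rightarrow> 'b set) \<Rightarrow> bool" where
  "finite_realizes n k a s A \<longleftrightarrow>
     (\<forall>i\<in>{1..n}. finite (A i) \<and> real (card (A i)) = a i) \<and>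
     real (card (\<Union>i\<in>{1..n}. A i)) = s \<and>
     k_intersections_empty n k A"

end

theory Submission
  imports Defs "HOL-Library.Real_Mod"
begin

text \<open>
  Necessity: if every point lies in at most \<open>m = k - 1\<close> of the sets, then integrating the sum of
  their indicator functions gives \<open>\<Sum>i. a i \<le> m * s\<close>.

  Sufficiency is McNaughton's wrap-around rule. Cut \<open>[0, T)\<close> with \<open>T = \<Sum>i. a i\<close> into consecutive
  intervals of lengths \<open>a i\<close> and reduce them modulo \<open>s\<close>. An interval does not overlap itself since
  \<open>a i \<le> s\<close>, the residues cover \<open>[0, s)\<close> since \<open>s \<le> T\<close>, and no residue is hit more than \<open>m\<close> times
  since \<open>T \<le> m * s\<close>. The resulting subsets of \<open>[0, s)\<close> are pulled back to the measure space along
  a function under which the preimage of an interval has the length of the interval as its measure.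
\<close>

section \<open>Families of bounded multiplicity\<close>

lemma k_intersections_empty_iff:
  "k_intersections_empty n k A \<longleftrightarrow> (\<forall>x. card {i\<in>{1..n}. x \<in> A i} < k)"
proof
  assume empty: "k_intersections_empty n k A"
  show "\<forall>x. card {i\<in>{1..n}. x \<in> A i} < k"
  proof (rule allI, rule ccontr)
    fix x
    assume "\<not> card {i\<in>{1..n}. x \<in> A i} < k"
    then obtain I where "I \<subseteq> {i\<in>{1..n}. x \<in> A i}" "card I = k"
      by (meson not_less obtain_subset_with_card_n)
    moreover from this have "x \<in> (\<Inter>i\<in>I. A i)"
      by blast
    ultimately show False
      using empty unfolding k_intersections_empty_def by blast
  qed
next
  assume multiplicity: "\<forall>x. card {i\<in>{1..n}. x \<in> A i} < k"
  have "x \<notin> (\<Inter>i\<in>I. A i)" if subset: "I \<subseteq> {1..n}" "card I = k" for I x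
  proof
    assume "x \<in> (\<Inter>i\<in>I. A i)"
    then have "card I \<le> card {i\<in>{1..n}. x \<in> A i}"
      using subset by (intro card_mono) auto
    then show False
      using multiplicity subset by (simp flip: not_less)
  qed
  then show "k_intersections_empty n k A"
    by (auto simp: k_intersections_empty_def)
qed

lemma sum_emeasure_le_multiplicity_mult_emeasure_UN:
  assumes "finite I" and sets: "\<And>i. i \<in> I \<Longrightarrow> A i \<in> sets M"
    and multiplicity: "\<And>x. card {i\<in>I. x \<in> A i} \<le> m"
  shows "(\<Sum>i\<in>I. emeasure M (A i)) \<le> of_nat m * emeasure M (\<Union>i\<in>I. A i)"
proof -
  let ?U = "\<Union>i\<in>I. A i"
  have pointwise: "(\<Sum>i\<in>I. indicator (A i) x) \<le> (of_nat m * indicator ?U x :: ennreal)" for x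
  proof (cases "x \<in> ?U")
    case True
    have "(\<Sum>i\<in>I. indicator (A i) x) = (of_nat (card {i\<in>I. x \<in> A i}) :: ennreal)"
      using \<open>finite I\<close> by (simp add: indicator_def Int_def)
    also have "\<dots> \<le> of_nat m"
      by (intro of_nat_mono multiplicity)
    finally show ?thesis
      using True by simp
  qed auto
  have "(\<Sum>i\<in>I. emeasure M (A i)) = (\<integral>\<^sup>+x. (\<Sum>i\<in>I. indicator (A i) x) \<partial>M)"
    by (subst nn_integral_sum) (simp_all add: sets borel_measurable_indicator)
  also have "\<dots> \<le> (\<integral>\<^sup>+x. of_nat m * indicator ?U x \<partial>M)"
    by (intro nn_integral_mono pointwise)
  also have "\<dots> = of_nat m * emeasure M ?U"
    using \<open>finite I\<close> sets by (intro nn_integral_cmult_indicator) auto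
  finally show ?thesis .
qed

definition realizes ::
  "'x measure \<Rightarrow> 'i set \<Rightarrow> nat \<Rightarrow> ('i \<Rightarrow> real) \<Rightarrow> real \<Rightarrow> ('i \<Rightarrow> 'x set) \<Rightarrow> bool" where
  "realizes M I m a s A \<longleftrightarrow>
     (\<forall>i\<in>I. A i \<in> sets M \<and> emeasure M (A i) = ennreal (a i)) \<and>
     emeasure M (\<Union>i\<in>I. A i) = ennreal s \<and>
     (\<forall>x. card {i\<in>I. x \<in> A i} \<le> m)"

lemma lebesgue_realizes_iff:
  assumes "k > 0"
  shows "lebesgue_realizes n k a s A \<longleftrightarrow> realizes lebesgue {1..n} (k - 1) a s A"
  using assms
  by (auto simp: lebesgue_realizes_def realizes_def k_intersections_empty_iff
      less_eq_Suc_le le_diff_conv2)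

lemma emeasure_count_space_eq_ennreal_iff:
  assumes "X \<subseteq> S" "r \<ge> 0"
  shows "emeasure (count_space S) X = ennreal r \<longleftrightarrow> finite X \<and> real (card X) = r"
  using assms by (cases "finite X") (auto simp: ennreal_of_nat_eq_real_of_nat)

lemma finite_realizes_iff:
  assumes "k > 0" "\<And>i. i \<in> {1..n} \<Longrightarrow> a i \<ge> 0" "s \<ge> 0"
  shows "finite_realizes n k a s A \<longleftrightarrow> realizes (count_space UNIV) {1..n} (k - 1) a s A"
  using assms
  by (auto simp: finite_realizes_def realizes_def k_intersections_empty_iff
      emeasure_count_space_eq_ennreal_iff less_eq_Suc_le le_diff_conv2)

lemma realizes_imp_bounds:
  assumes "finite I" and nonneg: "\<And>i. i \<in> I \<Longrightarrow> a i \<ge> 0" "s \<ge> 0"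
    and realizes: "realizes M I m a s A"
  shows "\<And>i. i \<in> I \<Longrightarrow> a i \<le> s" and "s \<le> sum a I" and "sum a I \<le> real m * s"
proof -
  let ?U = "\<Union>i\<in>I. A i"
  have sets: "\<And>i. i \<in> I \<Longrightarrow> A i \<in> sets M"
    and measures: "\<And>i. i \<in> I \<Longrightarrow> emeasure M (A i) = ennreal (a i)"
    and union: "emeasure M ?U = ennreal s"
    and multiplicity: "\<And>x. card {i\<in>I. x \<in> A i} \<le> m"
    using realizes by (auto simp: realizes_def)
  have sum_measures: "(\<Sum>i\<in>I. emeasure M (A i)) = ennreal (sum a I)"
    using nonneg by (simp add: measures)
  show "a i \<le> s" if "i \<in> I" for i
  proof -
    have "emeasure M (A i) \<le> emeasure M ?U"
      using \<open>finite I\<close> sets that by (intro emeasure_mono) auto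
    then show ?thesis
      using measures union nonneg that by simp
  qed
  have "emeasure M ?U \<le> (\<Sum>i\<in>I. emeasure M (A i))"
    using \<open>finite I\<close> sets by (intro emeasure_subadditive_finite) auto
  then show "s \<le> sum a I"
    using union sum_measures nonneg by (simp add: sum_nonneg)
  have "ennreal (sum a I) \<le> of_nat m * emeasure M ?U"
    using sum_emeasure_le_multiplicity_mult_emeasure_UN[OF \<open>finite I\<close> sets multiplicity]
    by (simp add: sum_measures)
  also have "\<dots> = ennreal (real m * s)"
    using nonneg by (simp add: union ennreal_mult ennreal_of_nat_eq_real_of_nat)
  finally show "sum a I \<le> real m * s"
    using nonneg by simp
qed

section \<open>Consecutive intervals reduced modulo \<open>s\<close>\<close>

definition sum_below :: "('i::linorder \<Rightarrow> 'a::comm_monoid_add) \<Rightarrow> 'i set \<Rightarrow> 'i \<Rightarrow> 'a" where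
  "sum_below a I i = (\<Sum>j | j \<in> I \<and> j < i. a j)"

lemma sum_below_add_le:
  fixes a :: "'i::linorder \<Rightarrow> 'a::ordered_comm_monoid_add"
  assumes "finite I" "\<And>i. i \<in> I \<Longrightarrow> a i \<ge> 0" "i \<in> I" "i < j"
  shows "sum_below a I i + a i \<le> sum_below a I j"
proof -
  have "sum_below a I i + a i = sum a (insert i {l\<in>I. l < i})"
    using \<open>finite I\<close> by (simp add: sum_below_def add.commute)
  also have "\<dots> \<le> sum_below a I j"
    unfolding sum_below_def using assms by (intro sum_mono2) auto
  finally show ?thesis .
qed

lemma UN_consecutive_intervals:
  fixes a :: "'i::linorder \<Rightarrow> 'a::linordered_ab_group_add"
  assumes "finite I" "\<And>i. i \<in> I \<Longrightarrow> a i \<ge> 0"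
  shows "(\<Union>i\<in>I. {sum_below a I i..<sum_below a I i + a i}) = {0..<sum a I}"
  using assms
proof (induction I rule: finite_linorder_max_induct)
  case (insert b I)
  have "sum_below a (insert b I) i = sum_below a I i" if "i \<in> I" for i
    unfolding sum_below_def using insert.hyps that by (intro sum.cong) auto
  moreover have "sum_below a (insert b I) b = sum a I"
    unfolding sum_below_def using insert.hyps by (intro sum.cong) auto
  ultimately have
    "(\<Union>i\<in>insert b I. {sum_below a (insert b I) i..<sum_below a (insert b I) i + a i}) =
      {sum a I..<sum a I + a b} \<union> (\<Union>i\<in>I. {sum_below a I i..<sum_below a I i + a i})"
    by simp
  also have "\<dots> = {0..<sum a I} \<union> {sum a I..<sum a I + a b}"
    using insert by auto
  also have "\<dots> = {0..<sum a I + a b}"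
    using insert.prems by (intro ivl_disj_un_two) (auto intro: sum_nonneg)
  also have "sum a I + a b = sum a (insert b I)"
    using insert.hyps by (subst sum.insert) auto
  finally show ?case .
qed simp

lemma consecutive_intervals_disjoint:
  fixes a :: "'i::linorder \<Rightarrow> 'a::linordered_ab_group_add"
  assumes "finite I" "\<And>i. i \<in> I \<Longrightarrow> a i \<ge> 0" "i \<in> I" "j \<in> I"
    and "x \<in> {sum_below a I i..<sum_below a I i + a i}"
    and "x \<in> {sum_below a I j..<sum_below a I j + a j}"
  shows "i = j"
  using sum_below_add_le[of I a i j] sum_below_add_le[of I a j i] assms
  by (cases i j rule: linorder_cases) auto

lemma rmod_image_idem:
  assumes "A \<subseteq> {0..<s}"
  shows "(\<lambda>x. x rmod s) ` A = A"
proof -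
  have "x rmod s = x" if "x \<in> A" for x
    using assms that by (intro rmod_idem) auto
  then show ?thesis
    by simp
qed

lemma rmod_image_atLeastLessThan_add_mult:
  "(\<lambda>x. x rmod s) ` {p + of_int q * s..<p + of_int q * s + c} = (\<lambda>x. x rmod s) ` {p..<p + c}"
proof -
  have "{p + of_int q * s..<p + of_int q * s + c} = (\<lambda>x. x + of_int q * s) ` {p..<p + c}"
    by (simp add: algebra_simps)
  moreover have "(x + of_int q * s) rmod s = x rmod s" for x
    using rmod_add[of x s "of_int q * s"] by simp
  ultimately show ?thesis
    by (simp only: image_image)
qed

lemma rmod_image_atLeastLessThan:
  assumes "s > 0" "c \<le> s"
  shows "(\<lambda>x. x rmod s) ` {p..<p + c} =
    {p rmod s..<min (p rmod s + c) s} \<union> {0..<p rmod s + c - s}"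
proof -
  define u where "u = p rmod s"
  have u_bounds: "0 \<le> u" "u < s"
    using \<open>s > 0\<close> by (auto simp: u_def rmod_nonneg rmod_less)
  have "p = u + of_int \<lfloor>p / s\<rfloor> * s"
    using \<open>s > 0\<close> by (simp add: u_def rmod_def)
  then have "(\<lambda>x. x rmod s) ` {p..<p + c} = (\<lambda>x. x rmod s) ` {u..<u + c}"
    by (metis rmod_image_atLeastLessThan_add_mult)
  also have "{u..<u + c} = {u..<min (u + c) s} \<union> {s..<u + c}"
    using u_bounds by auto
  also have "(\<lambda>x. x rmod s) ` \<dots> =
      (\<lambda>x. x rmod s) ` {u..<min (u + c) s} \<union> (\<lambda>x. x rmod s) ` {s..<u + c}"
    by (rule image_Un)
  also have "(\<lambda>x. x rmod s) ` {u..<min (u + c) s} = {u..<min (u + c) s}"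
    using u_bounds by (intro rmod_image_idem) auto
  also have "(\<lambda>x. x rmod s) ` {s..<u + c} = (\<lambda>x. x rmod s) ` {0..<u + c - s}"
    using rmod_image_atLeastLessThan_add_mult[of s 0 1 "u + c - s"] by simp
  also have "\<dots> = {0..<u + c - s}"
    using u_bounds \<open>c \<le> s\<close> by (intro rmod_image_idem) auto
  finally show ?thesis
    unfolding u_def .
qed

lemma rmod_image_atLeastLessThan_0:
  assumes "s > 0" "s \<le> t"
  shows "(\<lambda>x. x rmod s) ` {0..<t} = {0..<s}"
proof
  show "(\<lambda>x. x rmod s) ` {0..<t} \<subseteq> {0..<s}"
    using \<open>s > 0\<close> by (auto simp: rmod_nonneg rmod_less)
  have "(\<lambda>x. x rmod s) ` {0..<s} \<subseteq> (\<lambda>x. x rmod s) ` {0..<t}"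
    using \<open>s \<le> t\<close> by (intro image_mono) auto
  then show "{0..<s} \<subseteq> (\<lambda>x. x rmod s) ` {0..<t}"
    by (simp add: rmod_image_idem)
qed

lemma rmod_fibre_subset:
  assumes "s > 0"
  shows "{x \<in> {0..<real m * s}. x rmod s = t} \<subseteq> (\<lambda>q. t + real q * s) ` {..<m}"
proof
  fix x
  assume "x \<in> {x \<in> {0..<real m * s}. x rmod s = t}"
  then have quotient_bounds: "0 \<le> x / s" "x / s < real m" and residue: "x rmod s = t"
    using assms by (auto simp: field_simps)
  have "x = t + real (nat \<lfloor>x / s\<rfloor>) * s"
    using quotient_bounds residue assms by (auto simp: rmod_def)
  moreover have "nat \<lfloor>x / s\<rfloor> < m"
    using quotient_bounds by (simp add: nat_less_iff floor_less_iff)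
  ultimately show "x \<in> (\<lambda>q. t + real q * s) ` {..<m}"
    by blast
qed

definition wrapped_interval :: "real \<Rightarrow> ('i::linorder \<Rightarrow> real) \<Rightarrow> 'i set \<Rightarrow> 'i \<Rightarrow> real set" where
  "wrapped_interval s a I i = (\<lambda>x. x rmod s) ` {sum_below a I i..<sum_below a I i + a i}"

lemma UN_wrapped_interval:
  assumes "finite I" "\<And>i. i \<in> I \<Longrightarrow> a i \<ge> 0" "s > 0" "s \<le> sum a I"
  shows "(\<Union>i\<in>I. wrapped_interval s a I i) = {0..<s}"
proof -
  have "(\<Union>i\<in>I. wrapped_interval s a I i) = (\<lambda>x. x rmod s) ` {0..<sum a I}"
    using UN_consecutive_intervals[of I a] assms(1,2)
    by (simp add: wrapped_interval_def flip: image_UN)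
  also have "\<dots> = {0..<s}"
    using assms(3,4) by (rule rmod_image_atLeastLessThan_0)
  finally show ?thesis .
qed

lemma card_wrapped_interval_le:
  assumes "finite I" "\<And>i. i \<in> I \<Longrightarrow> a i \<ge> 0" "s > 0" "sum a I \<le> real m * s"
  shows "card {i\<in>I. t \<in> wrapped_interval s a I i} \<le> m"
proof -
  let ?J = "{i\<in>I. t \<in> wrapped_interval s a I i}"
  have "\<forall>i\<in>?J. \<exists>x\<in>{sum_below a I i..<sum_below a I i + a i}. x rmod s = t"
    by (auto simp: wrapped_interval_def)
  then obtain x where interval: "\<And>i. i \<in> ?J \<Longrightarrow> x i \<in> {sum_below a I i..<sum_below a I i + a i}"
    and residue: "\<And>i. i \<in> ?J \<Longrightarrow> x i rmod s = t"
    by metis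
  have "inj_on x ?J"
  proof (rule inj_onI)
    fix i j
    assume "i \<in> ?J" "j \<in> ?J" "x i = x j"
    then show "i = j"
      using consecutive_intervals_disjoint[of I a i j "x i"] assms(1,2)
        interval[of i] interval[of j] by simp
  qed
  moreover have "x ` ?J \<subseteq> (\<lambda>q. t + real q * s) ` {..<m}"
  proof -
    have "x i \<in> {0..<sum a I}" if "i \<in> ?J" for i
      using UN_consecutive_intervals[of I a] assms(1,2) interval[OF that] that by blast
    then have "x ` ?J \<subseteq> {x \<in> {0..<real m * s}. x rmod s = t}"
      using residue assms(4) by fastforce
    then show ?thesis
      using rmod_fibre_subset[OF \<open>s > 0\<close>] by blast
  qed
  ultimately show ?thesis
    using surj_card_le[of "{..<m}" "x ` ?J"] by (simp add: card_image)
qed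

section \<open>Measure spaces with an interval coordinate\<close>

text \<open>The set \<open>D\<close> of admissible endpoints is \<open>UNIV\<close> for Lebesgue measure and \<open>\<int>\<close> for counting
  measure. Only intervals in \<open>[0, \<infinity>)\<close> are constrained, so that points to be left out of every set
  can be sent to negative numbers.\<close>

locale interval_coordinate =
  fixes M :: "'x measure" and D :: "real set" and h :: "'x \<Rightarrow> real"
  assumes zero_mem: "0 \<in> D"
    and diff_mem: "x \<in> D \<Longrightarrow> y \<in> D \<Longrightarrow> x - y \<in> D"
    and sets_vimage: "u \<in> D \<Longrightarrow> v \<in> D \<Longrightarrow> 0 \<le> u \<Longrightarrow> u \<le> v \<Longrightarrow> h -` {u..<v} \<in> sets M"
    and emeasure_vimage:
      "u \<in> D \<Longrightarrow> v \<in> D \<Longrightarrow> 0 \<le> u \<Longrightarrow> u \<le> v \<Longrightarrow> emeasure M (h -` {u..<v}) = ennreal (v - u)"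
begin

lemma add_mem: "x \<in> D \<Longrightarrow> y \<in> D \<Longrightarrow> x + y \<in> D"
  using diff_mem[of x "0 - y"] diff_mem[OF zero_mem] by simp

lemma sum_mem: "(\<And>i. i \<in> I \<Longrightarrow> a i \<in> D) \<Longrightarrow> sum a I \<in> D"
  by (induction I rule: infinite_finite_induct) (auto simp: zero_mem add_mem)

lemma of_int_mult_mem:
  assumes "x \<in> D"
  shows "of_int q * x \<in> D"
proof (induction q rule: int_induct[of _ 0])
  case (step1 i)
  then show ?case
    using add_mem[OF step1(2) assms] by (simp add: algebra_simps)
next
  case (step2 i)
  then show ?case
    using diff_mem[OF step2(2) assms] by (simp add: algebra_simps)
qed (simp add: zero_mem)

lemma rmod_mem:
  assumes "x \<in> D" "y \<in> D" "y \<ge> 0"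
  shows "x rmod y \<in> D"
  using diff_mem[OF \<open>x \<in> D\<close> of_int_mult_mem[OF \<open>y \<in> D\<close>]] \<open>y \<ge> 0\<close>
  by (simp add: rmod_def mult.commute)

lemma vimage_rmod_image:
  assumes "p \<in> D" "c \<in> D" "s \<in> D" "s > 0" "0 \<le> c" "c \<le> s"
  shows "h -` (\<lambda>x. x rmod s) ` {p..<p + c} \<in> sets M"
    and "emeasure M (h -` (\<lambda>x. x rmod s) ` {p..<p + c}) = ennreal c"
proof -
  define u where "u = p rmod s"
  define v where "v = min (u + c) s"
  define w where "w = max 0 (u + c - s)"
  have "0 \<le> u" "u < s"
    using \<open>s > 0\<close> by (auto simp: u_def rmod_nonneg rmod_less)
  then have ordered: "0 \<le> u" "u \<le> v" "0 \<le> w" "w \<le> u"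
    using assms by (auto simp: v_def w_def)
  have mem: "u \<in> D" "v \<in> D" "w \<in> D"
    using assms by (auto simp: u_def v_def w_def min_def max_def rmod_mem add_mem diff_mem zero_mem)
  have decomposition: "h -` (\<lambda>x. x rmod s) ` {p..<p + c} = h -` {u..<v} \<union> h -` {0..<w}"
    unfolding rmod_image_atLeastLessThan[OF \<open>s > 0\<close> \<open>c \<le> s\<close>]
    by (auto simp: u_def v_def w_def)
  have pieces: "h -` {u..<v} \<in> sets M" "h -` {0..<w} \<in> sets M"
    using mem ordered zero_mem by (auto intro: sets_vimage)
  then show "h -` (\<lambda>x. x rmod s) ` {p..<p + c} \<in> sets M"
    unfolding decomposition by blast
  have "h -` {u..<v} \<inter> h -` {0..<w} = {}"
    using ordered by auto
  then have "emeasure M (h -` {u..<v} \<union> h -` {0..<w}) =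
      emeasure M (h -` {u..<v}) + emeasure M (h -` {0..<w})"
    using pieces by (intro plus_emeasure[symmetric])
  also have "\<dots> = ennreal (v - u) + ennreal w"
    using mem ordered zero_mem by (simp add: emeasure_vimage)
  also have "\<dots> = ennreal (v - u + w)"
    using ordered by (intro ennreal_plus[symmetric]) auto
  also have "v - u + w = c"
    by (auto simp: v_def w_def)
  finally show "emeasure M (h -` (\<lambda>x. x rmod s) ` {p..<p + c}) = ennreal c"
    unfolding decomposition .
qed

lemma realizes_vimage_wrapped_interval:
  fixes I :: "'i::linorder set"
  assumes "finite I" and "\<And>i. i \<in> I \<Longrightarrow> a i \<ge> 0" and mem: "\<And>i. i \<in> I \<Longrightarrow> a i \<in> D"
    and "s > 0" "s \<in> D"
    and "\<And>i. i \<in> I \<Longrightarrow> a i \<le> s" "s \<le> sum a I" "sum a I \<le> real m * s"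
  shows "realizes M I m a s (\<lambda>i. h -` wrapped_interval s a I i)"
  unfolding realizes_def
proof (intro conjI ballI allI)
  fix i
  assume "i \<in> I"
  moreover have "sum_below a I i \<in> D"
    using mem by (auto simp: sum_below_def intro: sum_mem)
  ultimately show "h -` wrapped_interval s a I i \<in> sets M"
    and "emeasure M (h -` wrapped_interval s a I i) = ennreal (a i)"
    using assms unfolding wrapped_interval_def by (auto intro!: vimage_rmod_image)
next
  have "(\<Union>i\<in>I. h -` wrapped_interval s a I i) = h -` {0..<s}"
    using UN_wrapped_interval[of I a s] assms by (simp flip: vimage_UN)
  then show "emeasure M (\<Union>i\<in>I. h -` wrapped_interval s a I i) = ennreal s"
    using emeasure_vimage[OF zero_mem \<open>s \<in> D\<close>] \<open>s > 0\<close> by simp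
next
  fix x
  show "card {i\<in>I. x \<in> h -` wrapped_interval s a I i} \<le> m"
    using card_wrapped_interval_le[of I a s m] assms by simp
qed

theorem ex_realizes_iff:
  fixes I :: "'i::linorder set"
  assumes "finite I" and nonneg: "\<And>i. i \<in> I \<Longrightarrow> a i \<ge> 0" and "\<And>i. i \<in> I \<Longrightarrow> a i \<in> D"
    and "s \<ge> 0" "s \<in> D"
  shows "(\<exists>A. realizes M I m a s A) \<longleftrightarrow>
    (\<forall>i\<in>I. a i \<le> s) \<and> sum a I \<le> real m * s \<and> s \<le> sum a I"
proof
  assume "\<exists>A. realizes M I m a s A"
  then show "(\<forall>i\<in>I. a i \<le> s) \<and> sum a I \<le> real m * s \<and> s \<le> sum a I"
    using realizes_imp_bounds[of I a s M m] assms by blast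
next
  assume bounds: "(\<forall>i\<in>I. a i \<le> s) \<and> sum a I \<le> real m * s \<and> s \<le> sum a I"
  show "\<exists>A. realizes M I m a s A"
  proof (cases "s = 0")
    case True
    then have "\<forall>i\<in>I. a i = 0"
      using nonneg bounds by force
    then have "realizes M I m a s (\<lambda>_. {})"
      using True by (simp add: realizes_def)
    then show ?thesis
      by blast
  next
    case False
    then show ?thesis
      using realizes_vimage_wrapped_interval[of I a s m] assms bounds by auto
  qed
qed

end

section \<open>Lebesgue measure and counting measure\<close>

text \<open>The coordinate is the volume of the ball of radius \<open>norm x\<close>, so preimages of intervals are
  spherical shells.\<close>

lemma interval_coordinate_lebesgue:
  "interval_coordinate lebesgue UNIV
     (\<lambda>x::'e::euclidean_space. unit_ball_vol DIM('e) * norm x ^ DIM('e))"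
    (is "interval_coordinate _ _ ?h")
proof
  let ?d = "DIM('e)"
  define r where "r v = root ?d (v / unit_ball_vol ?d)" for v :: real
  have pos: "unit_ball_vol (real ?d) > 0"
    by simp
  have r_nonneg: "r v \<ge> 0" if "v \<ge> 0" for v
    using that by (simp add: r_def)
  have volume_r: "unit_ball_vol ?d * r v ^ ?d = v" if "v \<ge> 0" for v
    using that by (simp add: r_def less_imp_neq[OF pos, symmetric])
  have ball: "?h x < v \<longleftrightarrow> x \<in> ball 0 (r v)" if "v \<ge> 0" for x v
  proof -
    have "norm x < r v \<longleftrightarrow> norm x ^ ?d < r v ^ ?d"
      using r_nonneg[OF that] by (simp flip: not_le)
    also have "\<dots> \<longleftrightarrow> ?h x < unit_ball_vol ?d * r v ^ ?d"
      by simp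
    finally show ?thesis
      using volume_r[OF that] by simp
  qed
  fix u v :: real
  assume ordered: "0 \<le> u" "u \<le> v"
  have shell: "?h -` {u..<v} = ball 0 (r v) - ball 0 (r u)"
    using ball ordered by (auto simp flip: not_less)
  then show "?h -` {u..<v} \<in> sets lebesgue"
    by simp
  have emeasure_ball_r: "emeasure lborel (ball (0::'e) (r w)) = ennreal w" if "w \<ge> 0" for w
    using r_nonneg[OF that] volume_r[OF that] by (simp add: emeasure_ball)
  have "ball (0::'e) (r u) \<subseteq> ball 0 (r v)"
    using ordered by (intro subset_ball) (simp add: r_def divide_right_mono)
  then have "emeasure lebesgue (?h -` {u..<v}) = ennreal v - ennreal u"
    unfolding shell using ordered by (subst emeasure_Diff) (auto simp: emeasure_ball_r)
  then show "emeasure lebesgue (?h -` {u..<v}) = ennreal (v - u)"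
    using ordered by (simp add: ennreal_minus)
qed auto

lemma interval_coordinate_count_space:
  fixes f :: "nat \<Rightarrow> 'b"
  assumes "inj f"
  shows "interval_coordinate (count_space UNIV) \<int>
      (\<lambda>x. if x \<in> range f then real (inv f x) else -1)"
    (is "interval_coordinate _ _ ?h")
proof
  fix u v :: real
  assume "u \<in> \<int>" "v \<in> \<int>" "0 \<le> u" "u \<le> v"
  then obtain p q where endpoints: "u = real p" "v = real q"
    by (metis Nats_cases Nats_altdef2 mem_Collect_eq order_trans)
  have "?h -` {u..<v} = f ` {p..<q}"
    using \<open>inj f\<close> by (auto simp: endpoints split: if_splits)
  moreover have "card (f ` {p..<q}) = q - p"
    using \<open>inj f\<close> by (simp add: card_image inj_on_subset)
  ultimately show "emeasure (count_space UNIV) (?h -` {u..<v}) = ennreal (v - u)"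
    using \<open>u \<le> v\<close> by (simp add: endpoints ennreal_of_nat_eq_real_of_nat)
qed auto

lemma Max_a_bar_le_iff:
  assumes "k \<ge> 2"
  shows "Max (insert (a_bar n k a) (a ` {1..n})) \<le> s \<longleftrightarrow>
    (\<forall>i\<in>{1..n}. a i \<le> s) \<and> (\<Sum>i=1..n. a i) \<le> real (k - 1) * s"
  using assms by (auto simp: a_bar_def field_simps)

theorem mainTheorem1:
  fixes n k :: nat and a :: "nat \<Rightarrow> real" and s :: real
  assumes "n \<ge> 2"
    and "\<And>i. i \<in> {1..n} \<Longrightarrow> a i \<ge> 0"
    and "2 \<le> k" and "k \<le> n"
    and "s \<ge> 0"
  shows "((\<exists>A :: nat \<Rightarrow> 'e::euclidean_space set. lebesgue_realizes n k a s A) \<longleftrightarrow>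
            Max (insert (a_bar n k a) (a ` {1..n})) \<le> s \<and> s \<le> (\<Sum>i=1..n. a i)) \<and>
         ((\<forall>i\<in>{1..n}. a i \<in> \<nat>) \<and> s \<in> \<nat> \<longrightarrow>
           ((\<exists>A :: nat \<Rightarrow> 'b::infinite set. finite_realizes n k a s A) \<longleftrightarrow>
              Max (insert (a_bar n k a) (a ` {1..n})) \<le> s \<and> s \<le> (\<Sum>i=1..n. a i)))"
proof (intro conjI impI)
  have "k > 0"
    using \<open>2 \<le> k\<close> by simp
  show "(\<exists>A :: nat \<Rightarrow> 'e set. lebesgue_realizes n k a s A) \<longleftrightarrow>
      Max (insert (a_bar n k a) (a ` {1..n})) \<le> s \<and> s \<le> (\<Sum>i=1..n. a i)"
    unfolding lebesgue_realizes_iff[OF \<open>k > 0\<close>] Max_a_bar_le_iff[OF \<open>2 \<le> k\<close>]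
    using assms(2,5)
      interval_coordinate.ex_realizes_iff[OF interval_coordinate_lebesgue, of "{1..n}" a s "k - 1"]
    by simp
  assume "(\<forall>i\<in>{1..n}. a i \<in> \<nat>) \<and> s \<in> \<nat>"
  then have integral: "\<And>i. i \<in> {1..n} \<Longrightarrow> a i \<in> \<int>" "s \<in> \<int>"
    using Nats_subset_Ints by blast+
  obtain f :: "nat \<Rightarrow> 'b" where "inj f"
    using infinite_UNIV infinite_countable_subset by blast
  note coordinate = interval_coordinate_count_space[OF \<open>inj f\<close>]
  have "finite_realizes n k a s A \<longleftrightarrow> realizes (count_space UNIV) {1..n} (k - 1) a s A"
    for A :: "nat \<Rightarrow> 'b set"
    using finite_realizes_iff \<open>k > 0\<close> assms(2,5) by blast
  then show "(\<exists>A :: nat \<Rightarrow> 'b set. finite_realizes n k a s A) \<longleftrightarrow>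
      Max (insert (a_bar n k a) (a ` {1..n})) \<le> s \<and> s \<le> (\<Sum>i=1..n. a i)"
    unfolding Max_a_bar_le_iff[OF \<open>2 \<le> k\<close>]
    using assms(2,5) integral
      interval_coordinate.ex_realizes_iff[OF coordinate, of "{1..n}" a s "k - 1"]
    by simp
qed

end
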